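(* Let $0<|q|<1$ and fix $\lambda\in\mathbb{C}^*\setminus q^{\mathbb{Z}}$. Let $\widetilde{\psi}^{\mathrm{A}}_\lambda(x):=\left(\mathcal{L}^+_{q,\lambda}\circ\mathcal{B}^+_q\,{}_1\psi_1\right)(0;b;q,x)$ be the $q$-Borel-Laplace transform of the divergent bilateral series ${}_1\psi_1(0;b;q,x)=\sum_{n\in\mathbb{Z}}\frac{1}{(b;q)_n}x^n$. Then for any $x\in\mathbb{C}^*\setminus[-\lambda;q]$, we have $$\widetilde{\psi}^{\mathrm{A}}_\lambda(x)=\frac{(q;q)_\infty}{(b;q)_\infty}\,\frac{\theta_q(\lambda)\,\theta_q\!\left(\frac{\lambda q}{bx}\right)}{\theta_q\!\left(\frac{q\lambda}{b}\right)\theta_q\!\left(\frac{\lambda}{x}\right)}\;{}_1\varphi_0(0;-;q,x).$$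
   Context: Notation. $(a;q)_0=1$, $(a;q)_n=(1-a)(1-aq)\cdots(1-aq^{n-1})$ for $n\ge1$, $(a;q)_n=\left[(1-aq^{-1})(1-aq^{-2})\cdots(1-aq^{n})\right]^{-1}$ for $n\le-1$, and $(a;q)_\infty=\lim_{n\to\infty}(a;q)_n$. The theta function is $\theta_q(z)=\sum_{n\in\mathbb{Z}}q^{n(n-1)/2}z^n$ for $z\in\mathbb{C}^*$. $[-\lambda;q]=\{-\lambda q^k:k\in\mathbb{Z}\}$. ${}_1\varphi_0(0;-;q,x)=\sum_{n\ge0}\frac{x^n}{(q;q)_n}$. $q$-Borel transformation: $(\mathcal{B}^+_qf)(\xi)=\sum_n a_nq^{n(n-1)/2}\xi^n$ for a formal series $f(x)=\sum_n a_nx^n$, applied here termwise to a bilateral series ($n\in\mathbb{Z}$). It sends ${}_1\psi_1(0;b;q,x)$ to $\psi_{\mathrm{A}}(\xi)=\sum_{n\in\mathbb{Z}}\frac{q^{n(n-1)/2}}{(b;q)_n}\xi^n$, which is evaluated, by a limiting case of Ramanujan's ${}_1\psi_1$ summation, as $\psi_{\mathrm{A}}(\xi)=\frac{(q;q)_\infty}{(b;q)_\infty}\frac{\theta_q(\xi)}{\theta_q(q\xi/b)}\left(-\frac{q\xi}{b};q\right)_\infty$. $q$-Laplace transformation: $(\mathcal{L}^+_{q,\lambda}\varphi)(x)=\sum_{n\in\mathbb{Z}}\frac{\varphi(\lambda q^n)}{\theta_q(\lambda q^n/x)}$. Thus $\widetilde{\psi}^{\mathrm{A}}_\lambda(x)=\sum_{n\in\mathbb{Z}}\frac{\psi_{\mathrm{A}}(\lambda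 q^n)}{\theta_q(\lambda q^n/x)}$. *)

theory Defs
  imports "HOL-Complex_Analysis.Complex_Analysis"
begin

text \<open>
  For \<open>n < 0\<close> a vanishing factor makes \<open>(a;q)\<^sub>n\<close> infinite; here it gets the value \<open>0\<close>, so that
  \<open>1 / (a;q)\<^sub>n = 0\<close>, which is the customary value of the reciprocal.
\<close>
definition qpoch :: "complex \<Rightarrow> complex \<Rightarrow> int \<Rightarrow> complex" where
  "qpoch a q n =
     (if n \<ge> 0 then (\<Prod>k<nat n. 1 - a * q ^ k)
      else inverse (\<Prod>k=1..nat (- n). 1 - a * q powi (- int k)))"

definition qpoch_inf :: "complex \<Rightarrow> complex \<Rightarrow> complex" where
  "qpoch_inf a q = lim (\<lambda>n. qpoch a q (int n))"

definition qtheta :: "complex \<Rightarrow> complex \<Rightarrow> complex" where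
  "qtheta q z = (\<Sum>\<^sub>\<infinity>n\<in>(UNIV::int set). q powi (n * (n - 1) div 2) * z powi n)"

text \<open>The spiral \<open>[a;q]\<close>; in particular \<open>[1;q]\<close> is the set of integer powers of \<open>q\<close>.\<close>
definition qspiral :: "complex \<Rightarrow> complex \<Rightarrow> complex set" where
  "qspiral a q = {a * q powi k |k::int. True}"

definition phi10 :: "complex \<Rightarrow> complex \<Rightarrow> complex" where
  "phi10 q x = (\<Sum>n. x ^ n / qpoch q q (int n))"

text \<open>A formal bilateral series is represented by its coefficient function.\<close>
definition psi11_coeff :: "complex \<Rightarrow> complex \<Rightarrow> int \<Rightarrow> complex" where
  "psi11_coeff b q n = 1 / qpoch b q n"

definition q_borel :: "complex \<Rightarrow> (int \<Rightarrow> complex) \<Rightarrow> complex \<Rightarrow> complex" where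
  "q_borel q a \<xi> = (\<Sum>\<^sub>\<infinity>n\<in>UNIV. a n * q powi (n * (n - 1) div 2) * \<xi> powi n)"

definition q_laplace :: "complex \<Rightarrow> complex \<Rightarrow> (complex \<Rightarrow> complex) \<Rightarrow> complex \<Rightarrow> complex" where
  "q_laplace q l \<phi> x =
     (\<Sum>\<^sub>\<infinity>n\<in>(UNIV::int set). \<phi> (l * q powi n) / qtheta q (l * q powi n / x))"

text \<open>
  Meromorphic continuation of \<open>f\<close> from \<open>S\<close> to \<open>D\<close>. It is unique on \<open>D\<close> if \<open>D\<close> is a domain and \<open>S\<close>
  is a subset of \<open>D\<close> with nonempty interior, because \<^const>\<open>nicely_meromorphic_on\<close> fills in
  removable singularities and fixes the value \<open>0\<close> at poles.
\<close>
definition mero_cont ::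
    "complex set \<Rightarrow> complex set \<Rightarrow> (complex \<Rightarrow> complex) \<Rightarrow> complex \<Rightarrow> complex" where
  "mero_cont D S f = (SOME g. g nicely_meromorphic_on D \<and> (\<forall>z\<in>S. g z = f z))"

text \<open>
  The Borel transform of the bilateral series converges for \<open>\<bar>\<xi>\<bar> > \<bar>b\<bar>\<close> (and in general nowhere
  else), whereas the Laplace transform evaluates it at points arbitrarily close to \<open>0\<close>; hence the
  continuation.
\<close>
definition psiA :: "complex \<Rightarrow> complex \<Rightarrow> complex \<Rightarrow> complex" where
  "psiA q b = mero_cont (- {0}) {\<xi>. norm \<xi> > norm b} (q_borel q (psi11_coeff b q))"

text \<open>
  The series defining the Laplace transform of \<^term>\<open>psiA q b\<close>, like the one defining
  \<^const>\<open>phi10\<close>, converges only for \<open>\<bar>x\<bar> < 1\<close> (except in the degenerate case that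
  \<open>\<theta>\<^sub>q(\<lambda>) = 0\<close>). For larger \<open>x\<close> both denote their continuations.
\<close>
definition psiA_tilde :: "complex \<Rightarrow> complex \<Rightarrow> complex \<Rightarrow> complex \<Rightarrow> complex" where
  "psiA_tilde q b l =
     mero_cont (- {0}) ({x. 0 < norm x \<and> norm x < 1} - qspiral (- l) q) (q_laplace q l (psiA q b))"

definition phi10_cont :: "complex \<Rightarrow> complex \<Rightarrow> complex" where
  "phi10_cont q = mero_cont UNIV (ball 0 1) (phi10 q)"

end

theory Submission
  imports Defs
begin

text \<open>
  Everything rests on one double series: for \<open>\<bar>d\<bar> < \<bar>\<xi>\<bar>\<close>,
  \<open>\<Sum>\<^sub>n q\<^bsup>n(n-1)/2\<^esup> \<xi>\<^sup>n (d q\<^sup>n; q)\<^sub>\<infinity> = \<theta>\<^sub>q(\<xi>) \<cdot> \<^sub>1\<phi>\<^sub>0(0; -; q, -d/\<xi>)\<close>.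
  With \<open>d = q\<close> it gives the Jacobi triple product. Since
  \<open>1 / (b; q)\<^sub>n = (b q\<^sup>n; q)\<^sub>\<infinity> / (b; q)\<^sub>\<infinity>\<close>, with \<open>d = b\<close> it evaluates the Borel transform as
  \<open>\<theta>\<^sub>q(\<xi>) / ((b; q)\<^sub>\<infinity> (-b/\<xi>; q)\<^sub>\<infinity>)\<close>. Rewriting \<open>1 / (-b/(\<lambda> q\<^sup>n); q)\<^sub>\<infinity>\<close> by the triple product
  turns the Laplace transform into the same series once more, now with \<open>d = -q\<lambda>/b\<close> and
  \<open>\<xi> = q\<lambda>/(bx)\<close>.
\<close>

subsection \<open>Summability and meromorphic continuation\<close>

text \<open>A bound \<open>c\<close> strictly between \<open>norm L\<close> and 1 eventually
  dominates the ratios. Stating the ratio as a recurrence lets terms of \<open>f\<close>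
  vanish.\<close>

lemma summable_norm_ratio_lim:
  fixes f :: "nat \<Rightarrow> 'a::real_normed_field"
  assumes rec: "\<And>n. f (Suc n) = r n * f n" and r: "r \<longlonglongrightarrow> L" and L: "norm L < 1"
  shows "summable (\<lambda>n. norm (f n))"
proof -
  obtain c where c: "norm L < c" "c < 1"
    using dense L by blast
  have "(\<lambda>n. norm (r n)) \<longlonglongrightarrow> norm L"
    using r by (rule tendsto_norm)
  hence "eventually (\<lambda>n. norm (r n) < c) sequentially"
    using c by (simp add: order_tendsto_iff)
  then obtain N where N: "\<And>n. n \<ge> N \<Longrightarrow> norm (r n) < c"
    by (auto simp: eventually_at_top_linorder)
  show ?thesis
  proof (rule summable_ratio_test[OF c(2)])
    fix n assume "n \<ge> N"
    thus "norm (norm (f (Suc n))) \<le> c * norm (norm (f n))"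
      using N[of n] by (auto simp: rec norm_mult intro!: mult_right_mono)
  qed
qed

lemma summable_on_int_norm:
  fixes f :: "int \<Rightarrow> 'a::banach"
  assumes "summable (\<lambda>n. norm (f (int n)))" "summable (\<lambda>n. norm (f (- int n)))"
  shows "(\<lambda>n. norm (f n)) summable_on UNIV"
proof -
  have "(\<lambda>n. norm (f n)) summable_on range int"
    using assms(1) by (subst summable_on_reindex) (auto simp: o_def intro!: norm_summable_imp_summable_on)
  moreover have "(\<lambda>n. norm (f n)) summable_on range (\<lambda>n. - int n)"
    using assms(2)
    by (subst summable_on_reindex) (auto simp: o_def inj_def intro!: norm_summable_imp_summable_on)
  ultimately have "(\<lambda>n. norm (f n)) summable_on (range int \<union> range (\<lambda>n. - int n))"
    by (rule summable_on_union)
  moreover have "n \<in> range int \<union> range (\<lambda>n. - int n)" for n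
    by (cases n rule: int_cases2) auto
  hence "range int \<union> range (\<lambda>n. - int n) = UNIV"
    by blast
  ultimately show ?thesis
    by simp
qed

text \<open>Absolute convergence of both series gives summability over the product set, so the
  iterated sum is the double sum.\<close>

lemma has_sum_Times_mult:
  fixes f g :: "_ \<Rightarrow> complex"
  assumes f: "(\<lambda>x. norm (f x)) summable_on A" "(f has_sum a) A"
    and g: "(\<lambda>y. norm (g y)) summable_on B" "(g has_sum b) B"
  shows "((\<lambda>(x, y). f x * g y) has_sum a * b) (A \<times> B)"
proof (rule has_sum_SigmaI)
  show "((\<lambda>y. case (x, y) of (x, y) \<Rightarrow> f x * g y) has_sum f x * b) B" for x
    using g(2) by (simp add: has_sum_cmult_right)
  show "((\<lambda>x. f x * b) has_sum a * b) A"
    using f(2) by (rule has_sum_cmult_left)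
  have "(\<lambda>p. norm (case p of (x, y) \<Rightarrow> f x * g y)) summable_on A \<times> B"
    using f(1) g(1)
    by (subst Infinite_Sum.abs_summable_on_Sigma_iff)
       (auto simp: norm_mult infsum_cmult_right' abs_mult abs_of_nonneg infsum_nonneg intro!: summable_on_cmult_right summable_on_cmult_left)
  thus "(\<lambda>(x, y). f x * g y) summable_on A \<times> B"
    by (rule Infinite_Sum.abs_summable_summable)
qed

text \<open>Identity theorem: \<open>remove_sings F\<close> meets the specification, hence so does
  the \<open>SOME\<close> term. Both agree on \<open>T\<close>, therefore off a sparse set, and
  niceness fixes the remaining values. The auxiliary open set \<open>T\<close> spares a proof that
  \<open>S\<close> is open.\<close>

lemma mero_cont_eq_remove_sings:
  assumes D: "open D" "connected D" "w \<in> D"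
    and T: "open T" "T \<noteq> {}" "T \<subseteq> S" "S \<subseteq> D"
    and F: "F meromorphic_on D"
    and S: "\<And>z. z \<in> S \<Longrightarrow> F analytic_on {z}" "\<And>z. z \<in> S \<Longrightarrow> f z = F z"
  shows "mero_cont D S f w = remove_sings F w"
proof -
  let ?P = "\<lambda>g. g nicely_meromorphic_on D \<and> (\<forall>z\<in>S. g z = f z)"
  define G where "G = remove_sings F"
  define g where "g = mero_cont D S f"
  have G: "?P G"
    unfolding G_def using F S by (auto intro: remove_sings_nicely_meromorphic)
  hence g: "?P g"
    unfolding g_def mero_cont_def by (rule someI[of ?P])
  have "(\<lambda>z. g z - G z) meromorphic_on D"
    using g G by (intro meromorphic_intros) (auto simp: nicely_meromorphic_on_def)
  then consider "eventually (\<lambda>z. g z - G z = 0) (cosparse D)"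
    | "eventually (\<lambda>z. g z - G z \<noteq> 0) (cosparse D)"
    using meromorphic_imp_constant_or_avoid D by blast
  thus ?thesis
  proof cases
    case 1
    \<comment> \<open>Agreement on a punctured neighbourhood transfers poles and limits; a nicely
      meromorphic function takes its limit as value, or 0 at a pole.\<close>
    hence ev: "eventually (\<lambda>z. g z = G z) (at w)"
      using D by (auto simp: eventually_cosparse_open_eq)
    hence pole: "is_pole g w \<longleftrightarrow> is_pole G w"
      by (intro is_pole_cong) auto
    have lim: "(g \<longlongrightarrow> c) (at w) \<longleftrightarrow> (G \<longlongrightarrow> c) (at w)" for c
      using ev by (rule tendsto_cong)
    have *: "(is_pole h w \<and> h w = 0) \<or> h \<midarrow>w\<rightarrow> h w" if "?P h" for h
      using that D by (auto simp: nicely_meromorphic_on_def)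
    have "g w = G w"
    proof (cases "is_pole g w")
      case True
      hence "\<not> g \<midarrow>w\<rightarrow> c" for c
        by (metis at_neq_bot is_pole_def not_tendsto_and_filterlim_at_infinity)
      thus ?thesis
        using *[OF g] *[OF G] by (simp add: lim)
    next
      case False
      thus ?thesis
        using *[OF g] *[OF G] pole lim LIM_unique by metis
    qed
    thus ?thesis
      by (simp add: g_def G_def)
  next
    case 2
    obtain t where t: "t \<in> T"
      using T by blast
    have "eventually (\<lambda>z. g z - G z \<noteq> 0) (at t)"
      using 2 D T t by (auto simp: eventually_cosparse_open_eq)
    moreover have "eventually (\<lambda>z. z \<in> T) (at t)"
      using T t by (intro eventually_at_in_open') auto
    ultimately have "eventually (\<lambda>z. False) (at t)"
      by eventually_elim (use g G T in auto)
    thus ?thesis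
      by simp
  qed
qed

lemma open_connected_punctured: "open (- {0 :: complex})" "connected (- {0 :: complex})"
  by (auto intro!: connected_punctured_universe)

lemma open_norm_annulus: "open {x :: 'a::real_normed_vector. a < norm x \<and> norm x < b}"
  by (intro open_Collect_conj open_Collect_less continuous_intros)

lemma norm_annulus_nonempty:
  assumes "0 \<le> a" "a < b"
  shows "{x :: 'a::real_normed_algebra_1. a < norm x \<and> norm x < b} \<noteq> {}"
proof -
  have "of_real ((a + b) / 2) \<in> {x :: 'a. a < norm x \<and> norm x < b}"
    using assms by (simp del: of_real_add of_real_divide)
  thus ?thesis
    by blast
qed

subsection \<open>Euler's identities\<close>

definition qtri :: "complex \<Rightarrow> int \<Rightarrow> complex" where
  "qtri q n = q powi (n * (n - 1) div 2)"

lemma triangle_add: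
  "(m + n) * (m + n - 1) div 2 = m * (m - 1) div 2 + n * (n - 1) div 2 + m * (n::int)"
proof -
  have "even (m * (m - 1))" "even (n * (n - 1))"
    by auto
  then obtain i j where ij: "m * (m - 1) = 2 * i" "n * (n - 1) = 2 * j"
    unfolding dvd_def by blast
  have "(m + n) * (m + n - 1) = 2 * (i + j + m * n)"
    using ij by (simp add: algebra_simps)
  thus ?thesis
    by (simp only: ij) simp
qed

locale q_base =
  fixes q :: complex
  assumes q_pos: "0 < norm q" and q_less_1: "norm q < 1"
begin

lemma q_nz [simp]: "q \<noteq> 0"
  using q_pos by auto

lemma q_power_tendsto_0: "(\<lambda>n. q ^ n) \<longlonglongrightarrow> 0"
  using q_less_1 by (rule LIMSEQ_power_zero)

lemma q_power_neq_1 [simp]: "q * q ^ n \<noteq> 1"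
proof
  assume "q * q ^ n = 1"
  hence "norm q ^ Suc n = 1"
    by (metis norm_one norm_power power_Suc)
  thus False
    using q_less_1 q_pos power_Suc_less_one[of "norm q" n] by simp
qed

text \<open>The cross term \<open>q powi (m * n)\<close> is behind both the quasi-periodicity of
  theta and the factorisation of the double series.\<close>

lemma qtri_add: "qtri q (m + n) = qtri q m * qtri q n * q powi (m * n)"
  by (simp add: qtri_def triangle_add power_int_add)

lemma qtri_nz [simp]: "qtri q n \<noteq> 0"
  by (simp add: qtri_def)

lemma qtri_0 [simp]: "qtri q 0 = 1" and qtri_1 [simp]: "qtri q 1 = 1"
  by (simp_all add: qtri_def)

lemma qtri_Suc: "qtri q (int (Suc n)) = q ^ n * qtri q (int n)"
  using qtri_add[of "int n" 1] by (simp add: add.commute)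

lemma qtri_minus_Suc: "qtri q (- int (Suc n)) = q * q ^ n * qtri q (- int n)"
proof -
  have "qtri q (-1) = q"
    by (simp add: qtri_def)
  moreover have "- int (Suc n) = - int n + (-1)"
    by simp
  ultimately show ?thesis
    using qtri_add[of "- int n" "-1"] by (simp only:) simp
qed

lemma qpoch_0 [simp]: "qpoch a q 0 = 1"
  by (simp add: qpoch_def)

lemma qpoch_Suc: "qpoch a q (int (Suc n)) = qpoch a q (int n) * (1 - a * q ^ n)"
  by (simp add: qpoch_def del: of_nat_Suc)

lemma qpoch_nz: "(\<And>k. a * q ^ k \<noteq> 1) \<Longrightarrow> qpoch a q (int n) \<noteq> 0"
  by (auto simp: qpoch_def)

lemma qpoch_q_nz [simp]: "qpoch q q (int n) \<noteq> 0"
  by (rule qpoch_nz) simp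

text \<open>Coefficients of Euler's expansion of \<open>(-z; q)_inf\<close> in powers of
  \<open>z\<close>.\<close>

definition euler_coeff :: "nat \<Rightarrow> complex" where
  "euler_coeff k = qtri q (int k) / qpoch q q (int k)"

lemma euler_coeff_0 [simp]: "euler_coeff 0 = 1"
  by (simp add: euler_coeff_def)

lemma euler_coeff_Suc: "euler_coeff (Suc k) * (1 - q * q ^ k) = q ^ k * euler_coeff k"
  unfolding euler_coeff_def qtri_Suc qpoch_Suc by (simp add: divide_simps)

lemma summable_norm_euler: "summable (\<lambda>k. norm (euler_coeff k * z ^ k))"
proof (rule summable_norm_ratio_lim[where L = 0])
  fix k
  show "euler_coeff (Suc k) * z ^ Suc k = (q ^ k * z / (1 - q * q ^ k)) * (euler_coeff k * z ^ k)"
    using euler_coeff_Suc[of k] by (simp add: divide_simps)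
next
  have "(\<lambda>k. q ^ k * z / (1 - q * q ^ k)) \<longlonglongrightarrow> 0 * z / (1 - q * 0)"
    by (intro tendsto_intros q_power_tendsto_0) auto
  thus "(\<lambda>k. q ^ k * z / (1 - q * q ^ k)) \<longlonglongrightarrow> 0"
    by simp
next
  show "norm (0 :: complex) < 1"
    by simp
qed

text \<open>This will turn out to be \<open>(-z; q)_inf\<close>. It starts as an everywhere
  convergent power series because the limit in \<open>qpoch_inf\<close> is not yet known to
  exist.\<close>

definition euler_exp :: "complex \<Rightarrow> complex" where
  "euler_exp z = (\<Sum>k. euler_coeff k * z ^ k)"

lemma euler_exp_sums: "(\<lambda>k. euler_coeff k * z ^ k) sums euler_exp z"
  using summable_norm_euler[of z] by (simp add: euler_exp_def summable_norm_cancel summable_sums)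

lemma euler_exp_holomorphic: "euler_exp holomorphic_on UNIV"
  unfolding holomorphic_on_def field_differentiable_def euler_exp_def [abs_def]
  using termdiffs_strong_converges_everywhere[of euler_coeff] euler_exp_sums
  by (meson has_field_derivative_at_within sums_summable)

lemma euler_exp_shift: "euler_exp z = (1 + z) * euler_exp (q * z)"
proof -
  have "(\<lambda>k. euler_coeff k * z ^ k - euler_coeff k * (q * z) ^ k) sums (euler_exp z - euler_exp (q * z))"
    by (intro sums_diff euler_exp_sums)
  \<comment> \<open>The constant terms cancel, so the index can be shifted without a remainder; the
    recurrence of the coefficients then applies to every term.\<close>
  hence "(\<lambda>k. euler_coeff (Suc k) * z ^ Suc k - euler_coeff (Suc k) * (q * z) ^ Suc k)
           sums (euler_exp z - euler_exp (q * z))"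
    using sums_Suc_iff[of "\<lambda>k. euler_coeff k * z ^ k - euler_coeff k * (q * z) ^ k"]
    by (simp del: power_Suc)
  also have "(\<lambda>k. euler_coeff (Suc k) * z ^ Suc k - euler_coeff (Suc k) * (q * z) ^ Suc k) =
             (\<lambda>k. z * (euler_coeff k * (q * z) ^ k))"
  proof
    fix k
    have "euler_coeff (Suc k) * z ^ Suc k - euler_coeff (Suc k) * (q * z) ^ Suc k =
            (euler_coeff (Suc k) * (1 - q * q ^ k)) * z ^ Suc k"
      by (simp add: algebra_simps power_mult_distrib)
    thus "euler_coeff (Suc k) * z ^ Suc k - euler_coeff (Suc k) * (q * z) ^ Suc k =
            z * (euler_coeff k * (q * z) ^ k)"
      unfolding euler_coeff_Suc by (simp add: algebra_simps power_mult_distrib)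
  qed
  finally have "euler_exp z - euler_exp (q * z) = z * euler_exp (q * z)"
    using sums_mult[OF euler_exp_sums[of "q * z"], of z] sums_unique2 by blast
  thus ?thesis
    by (simp add: algebra_simps)
qed

section \<open>The infinite q-Pochhammer symbol: existence, zeros, bilateral shifts\<close>

lemma euler_exp_eq_qpoch: "euler_exp z = qpoch (- z) q (int n) * euler_exp (z * q ^ n)"
proof (induction n)
  case (Suc n)
  have "euler_exp (z * q ^ n) = (1 + z * q ^ n) * euler_exp (z * q ^ Suc n)"
    using euler_exp_shift[of "z * q ^ n"] by (simp add: mult_ac)
  thus ?case
    using Suc unfolding qpoch_Suc by simp
qed simp

lemma euler_exp_tendsto: "(\<lambda>n. euler_exp (z * q ^ n)) \<longlonglongrightarrow> 1"
proof -
  have "isCont euler_exp 0"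
    by (meson DERIV_isCont UNIV_I euler_exp_holomorphic holomorphic_derivI open_UNIV)
  moreover have "(\<lambda>n. z * q ^ n) \<longlonglongrightarrow> 0"
    using tendsto_mult_left[OF q_power_tendsto_0, of z] by simp
  ultimately have "(\<lambda>n. euler_exp (z * q ^ n)) \<longlonglongrightarrow> euler_exp 0"
    by (rule isCont_tendsto_compose)
  thus ?thesis
    by (simp add: euler_exp_def)
qed

text \<open>Solve \<open>euler_exp_eq_qpoch\<close> for the finite product: the denominator
  \<open>euler_exp (- a * q ^ n)\<close> tends to 1. So the limit defining \<open>qpoch_inf\<close>
  exists.\<close>

lemma qpoch_tendsto: "(\<lambda>n. qpoch a q (int n)) \<longlonglongrightarrow> euler_exp (- a)"
proof -
  have ev: "eventually (\<lambda>n. euler_exp (- a * q ^ n) \<noteq> 0) sequentially"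
    using euler_exp_tendsto[of "- a"] by (rule tendsto_imp_eventually_ne) simp
  have "(\<lambda>n. euler_exp (- a) / euler_exp (- a * q ^ n)) \<longlonglongrightarrow> euler_exp (- a) / 1"
    by (intro tendsto_divide tendsto_const euler_exp_tendsto) simp
  moreover have "eventually (\<lambda>n. euler_exp (- a) / euler_exp (- a * q ^ n) = qpoch a q (int n)) sequentially"
    using ev
  proof eventually_elim
    case (elim n)
    thus ?case
      using euler_exp_eq_qpoch[of "- a" n] by simp
  qed
  ultimately show ?thesis
    by (simp add: Lim_transform_eventually)
qed

lemma qpoch_inf_euler: "qpoch_inf a q = euler_exp (- a)"
  unfolding qpoch_inf_def using qpoch_tendsto by (rule limI)

lemma qpoch_inf_sums: "(\<lambda>k. euler_coeff k * (- a) ^ k) sums qpoch_inf a q"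
  unfolding qpoch_inf_euler by (rule euler_exp_sums)

lemma qpoch_inf_holomorphic: "(\<lambda>a. qpoch_inf a q) holomorphic_on A"
  unfolding qpoch_inf_euler
  by (rule holomorphic_on_compose_gen[OF _ euler_exp_holomorphic, unfolded o_def])
     (auto intro: holomorphic_intros)

lemma qpoch_inf_split: "qpoch_inf a q = qpoch a q (int n) * qpoch_inf (a * q ^ n) q"
  using euler_exp_eq_qpoch[of "- a" n] by (simp add: qpoch_inf_euler)

lemma qpoch_inf_shift: "qpoch_inf a q = (1 - a) * qpoch_inf (a * q) q"
  using qpoch_inf_split[of a 1] by (simp add: qpoch_def)

text \<open>Far enough out the tail of the product is nonzero, since it tends to 1; a zero must come
  from the finite part.\<close>

lemma qpoch_inf_eq_0_iff: "qpoch_inf a q = 0 \<longleftrightarrow> (\<exists>n. a * q ^ n = 1)"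
proof
  assume *: "qpoch_inf a q = 0"
  have "eventually (\<lambda>n. euler_exp (- a * q ^ n) \<noteq> 0) sequentially"
    using euler_exp_tendsto[of "- a"] by (rule tendsto_imp_eventually_ne) simp
  then obtain n where "euler_exp (- a * q ^ n) \<noteq> 0"
    by (auto simp: eventually_sequentially)
  hence "qpoch a q (int n) = 0"
    using * qpoch_inf_split[of a n] by (simp add: qpoch_inf_euler)
  thus "\<exists>n. a * q ^ n = 1"
    using qpoch_nz by blast
next
  assume "\<exists>n. a * q ^ n = 1"
  then obtain n where "a * q ^ n = 1" ..
  thus "qpoch_inf a q = 0"
    \<comment> \<open>The vanishing factor has exponent \<open>n\<close>, so \<open>Suc n\<close>
      factors must be split off.\<close>
    by (subst qpoch_inf_split[of _ "Suc n"], subst qpoch_Suc) simp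
qed

lemma qpoch_inf_nz_if_norm_less_1:
  assumes "norm a < 1"
  shows "qpoch_inf a q \<noteq> 0"
proof -
  have "norm (a * q ^ n) < 1" for n
  proof -
    have "norm (a * q ^ n) \<le> norm a * 1"
      unfolding norm_mult norm_power
      by (intro mult_left_mono power_le_one) (use q_less_1 in auto)
    thus ?thesis
      using assms by simp
  qed
  thus ?thesis
    unfolding qpoch_inf_eq_0_iff by (metis norm_one less_irrefl)
qed

lemma qpoch_inf_q_nz [simp]: "qpoch_inf q q \<noteq> 0"
  using q_less_1 by (rule qpoch_inf_nz_if_norm_less_1)

text \<open>Makes the coefficients \<open>1 / (b; q)_n\<close> values of a single entire function,
  for both signs of \<open>n\<close>.\<close>

lemma qpoch_inf_powi:
  assumes "\<And>n. b * q ^ n \<noteq> 1"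
  shows "qpoch_inf (b * q powi n) q = qpoch_inf b q / qpoch b q n"
proof (cases "n \<ge> 0")
  case True
  then obtain m where "n = int m"
    using nonneg_int_cases by blast
  thus ?thesis
    using qpoch_inf_split[of b m] qpoch_nz[OF assms] by simp
next
  case False
  define m where "m = nat (- n)"
  have n: "n = - int m"
    using False by (simp add: m_def)
  have "qpoch_inf (b * q powi (- int m)) q =
          qpoch_inf b q * (\<Prod>k=1..m. 1 - b * q powi (- int k))" for m
  proof (induction m)
    case (Suc m)
    let ?c = "b * q powi (- int (Suc m))"
    have "q powi (- int (Suc m)) * q = q powi (- int m)"
      using power_int_minus_mult[of q "- int m"] by (simp add: minus_diff_commute)
    hence "?c * q = b * q powi (- int m)"
      by (metis mult.assoc)
    hence "qpoch_inf ?c q = (1 - ?c) * qpoch_inf (b * q powi (- int m)) q"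
      by (metis qpoch_inf_shift)
    also have "\<dots> = qpoch_inf b q * (\<Prod>k=1..Suc m. 1 - b * q powi (- int k))"
      unfolding Suc by simp
    finally show ?case .
  qed simp
  \<comment> \<open>Dividing by an \<open>inverse\<close> is multiplying by the product, even if a
    factor vanishes, because \<open>inverse 0 = 0\<close>.\<close>
  from this[of m] show ?thesis
    using False by (simp add: qpoch_def n divide_inverse)
qed

section \<open>The series \<open>phi10\<close> as a reciprocal product\<close>

lemma summable_norm_phi10:
  assumes "norm x < 1"
  shows "summable (\<lambda>n. norm (x ^ n / qpoch q q (int n)))"
proof (rule summable_norm_ratio_lim)
  fix k
  show "x ^ Suc k / qpoch q q (int (Suc k)) = (x / (1 - q * q ^ k)) * (x ^ k / qpoch q q (int k))"
    unfolding qpoch_Suc by (simp add: divide_simps)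
next
  have "(\<lambda>k. x / (1 - q * q ^ k)) \<longlonglongrightarrow> x / (1 - q * 0)"
    by (intro tendsto_intros q_power_tendsto_0) auto
  thus "(\<lambda>k. x / (1 - q * q ^ k)) \<longlonglongrightarrow> x"
    by simp
qed fact

lemma phi10_sums:
  assumes "norm x < 1"
  shows "(\<lambda>n. x ^ n / qpoch q q (int n)) sums phi10 q x"
  unfolding phi10_def
  using summable_norm_phi10[OF assms] by (simp add: summable_norm_cancel summable_sums)

lemma phi10_shift:
  assumes "norm x < 1"
  shows "phi10 q (x * q) = (1 - x) * phi10 q x"
proof -
  have xq: "norm (x * q) < 1"
    using assms q_less_1 mult_strict_mono[of "norm x" 1 "norm q" 1] by (simp add: norm_mult)
  let ?f = "\<lambda>x n. x ^ n / qpoch q q (int n)"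
  have "(\<lambda>n. ?f x n - ?f (x * q) n) sums (phi10 q x - phi10 q (x * q))"
    by (intro sums_diff phi10_sums assms xq)
  hence "(\<lambda>n. ?f x (Suc n) - ?f (x * q) (Suc n)) sums (phi10 q x - phi10 q (x * q))"
    using sums_Suc_iff[of "\<lambda>n. ?f x n - ?f (x * q) n"] by (simp del: power_Suc of_nat_Suc)
  also have "(\<lambda>n. ?f x (Suc n) - ?f (x * q) (Suc n)) = (\<lambda>n. x * ?f x n)"
  proof
    fix n
    have "?f x (Suc n) - ?f (x * q) (Suc n) = x ^ Suc n * (1 - q * q ^ n) / qpoch q q (int (Suc n))"
      by (simp add: algebra_simps power_mult_distrib diff_divide_distrib)
    thus "?f x (Suc n) - ?f (x * q) (Suc n) = x * ?f x n"
      unfolding qpoch_Suc by simp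
  qed
  finally have "phi10 q x - phi10 q (x * q) = x * phi10 q x"
    using sums_mult[OF phi10_sums[OF assms], of x] sums_unique2 by blast
  thus ?thesis
    by (simp add: algebra_simps)
qed

text \<open>Iterating the shift drives the argument to 0, where the series is continuous with value
  1, while the factors collected on the way tend to \<open>(x; q)_inf\<close>.\<close>

lemma phi10_eq:
  assumes "norm x < 1"
  shows "phi10 q x = 1 / qpoch_inf x q"
proof -
  have less: "norm (x * q ^ n) < 1" for n
    using assms q_less_1 mult_left_mono[of "norm q ^ n" 1 "norm x"] power_le_one[of "norm q" n]
    by (simp add: norm_mult norm_power)
  have eq: "phi10 q (x * q ^ n) = qpoch x q (int n) * phi10 q x" for n
  proof (induction n)
    case (Suc n)
    thus ?case
      unfolding qpoch_Suc using phi10_shift[OF less[of n]] by (simp add: mult_ac)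
  qed simp
  have "isCont (\<lambda>x. \<Sum>n. (1 / qpoch q q (int n)) * x ^ n) 0"
    by (rule isCont_powser[where K = "1/2"])
       (use phi10_sums[of "1/2"] in \<open>auto simp: sums_iff\<close>)
  hence "isCont (phi10 q) 0"
    by (simp add: phi10_def [abs_def])
  moreover have "(\<lambda>n. x * q ^ n) \<longlonglongrightarrow> 0"
    using tendsto_mult_left[OF q_power_tendsto_0, of x] by simp
  ultimately have "(\<lambda>n. phi10 q (x * q ^ n)) \<longlonglongrightarrow> phi10 q 0"
    by (rule isCont_tendsto_compose)
  moreover have "phi10 q 0 = 1"
    using powser_zero[of "\<lambda>n. 1 / qpoch q q (int n)"] by (simp add: phi10_def)
  moreover have "(\<lambda>n. phi10 q (x * q ^ n)) \<longlonglongrightarrow> qpoch_inf x q * phi10 q x"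
    unfolding eq qpoch_inf_euler by (intro tendsto_intros qpoch_tendsto)
  ultimately have "qpoch_inf x q * phi10 q x = 1"
    using LIMSEQ_unique by metis
  thus ?thesis
    using qpoch_inf_nz_if_norm_less_1[OF assms] by (simp add: field_simps)
qed

subsection \<open>The theta function\<close>

text \<open>Triangular numbers grow quadratically in both directions, so the ratio of consecutive
  terms tends to 0 at either end.\<close>

lemma theta_summable:
  assumes "z \<noteq> 0"
  shows "(\<lambda>n. norm (qtri q n * z powi n)) summable_on UNIV"
proof (rule summable_on_int_norm)
  show "summable (\<lambda>n. norm (qtri q (int n) * z powi int n))"
  proof (rule summable_norm_ratio_lim)
    show "qtri q (int (Suc n)) * z powi int (Suc n) = (q ^ n * z) * (qtri q (int n) * z powi int n)" for n
      unfolding qtri_Suc power_int_of_nat by simp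
    show "(\<lambda>n. q ^ n * z) \<longlonglongrightarrow> 0 * z"
      by (intro tendsto_intros q_power_tendsto_0)
  qed simp
  show "summable (\<lambda>n. norm (qtri q (- int n) * z powi - int n))"
  proof (rule summable_norm_ratio_lim)
    show "qtri q (- int (Suc n)) * z powi - int (Suc n) =
            (q * q ^ n / z) * (qtri q (- int n) * z powi - int n)" for n
      unfolding qtri_minus_Suc power_int_minus power_int_of_nat using assms by (simp add: field_simps)
    show "(\<lambda>n. q * q ^ n / z) \<longlonglongrightarrow> q * 0 / z"
      by (intro tendsto_intros q_power_tendsto_0 assms)
  qed simp
qed

lemma theta_has_sum:
  assumes "z \<noteq> 0"
  shows "((\<lambda>n. qtri q n * z powi n) has_sum qtheta q z) UNIV"
  unfolding qtheta_def qtri_def [symmetric]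
  using theta_summable[OF assms] by (intro has_sum_infsum) (rule abs_summable_summable)

text \<open>Reindex by \<open>k\<close>; the cross term of \<open>qtri_add\<close> is absorbed into
  \<open>(z * q powi k) powi n\<close>.\<close>

lemma theta_shift:
  assumes "z \<noteq> 0"
  shows "qtheta q (z * q powi k) = qtheta q z / (qtri q k * z powi k)"
proof -
  have "((\<lambda>n. qtri q (n + k) * z powi (n + k)) has_sum qtheta q z) UNIV"
    by (rule has_sum_reindex_bij_witness[where i = "\<lambda>n. n - k" and j = "\<lambda>n. n + k", THEN iffD2,
          OF _ _ _ _ _ refl theta_has_sum[OF assms]]) auto
  hence "((\<lambda>n. qtri q (n + k) * z powi (n + k) * (1 / (qtri q k * z powi k))) has_sum
           qtheta q z * (1 / (qtri q k * z powi k))) UNIV"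
    by (rule has_sum_cmult_left)
  also have "(\<lambda>n. qtri q (n + k) * z powi (n + k) * (1 / (qtri q k * z powi k))) =
             (\<lambda>n. qtri q n * (z * q powi k) powi n)"
    using assms
    by (simp add: fun_eq_iff qtri_add power_int_add power_int_mult_distrib mult.commute
             flip: power_int_mult)
  finally show ?thesis
    using has_sum_unique[OF theta_has_sum[of "z * q powi k"]] assms by simp
qed

text \<open>
  After expanding \<open>(d q\<^sup>n; q)\<^sub>\<infinity>\<close> by Euler's identity, the exponents of \<open>q\<close> combine to
  \<open>(n + k) (n + k - 1) / 2\<close>, so the double series factors along \<open>N = n + k\<close>.
\<close>
lemma theta_qpoch_inf_has_sum:
  assumes xi: "xi \<noteq> 0" and d: "norm d < norm xi"
  shows "((\<lambda>n. qtri q n * xi powi n * qpoch_inf (d * q powi n) q) has_sum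
           qtheta q xi * phi10 q (- d / xi)) UNIV"
proof (rule has_sum_SigmaD)
  let ?f = "\<lambda>n. qtri q n * xi powi n"
  let ?g = "\<lambda>k. (- d / xi) ^ k / qpoch q q (int k)"
  let ?h = "\<lambda>(n, k). ?f n * (euler_coeff k * (- (d * q powi n)) ^ k)"
  have less: "norm (- d / xi) < 1"
    using assms by (simp add: norm_divide)
  have g: "summable (\<lambda>k. norm (?g k))" "?g sums phi10 q (- d / xi)"
    by (rule summable_norm_phi10[OF less], rule phi10_sums[OF less])
  \<comment> \<open>Both factors converge absolutely, the second because
    \<open>norm d < norm xi\<close>; this justifies substituting \<open>N = n + k\<close> in the
    double series.\<close>
  have "((\<lambda>(N, k). ?f N * ?g k) has_sum qtheta q xi * phi10 q (- d / xi)) (UNIV \<times> UNIV)"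
    by (intro has_sum_Times_mult theta_summable theta_has_sum xi norm_summable_imp_has_sum
              norm_summable_imp_summable_on g) (use g in simp)
  moreover have "(case (n + int k, k) of (N, k) \<Rightarrow> ?f N * ?g k) = ?h (n, k)" for n k
  proof -
    have "(d / xi) ^ k * xi powi (n + int k) = d ^ k * xi powi n"
      using xi by (simp add: power_int_add power_divide)
    moreover have "q powi (n * int k) = (q powi n) ^ k"
      by (simp add: power_int_mult)
    ultimately show ?thesis
      using xi
      by (simp add: euler_coeff_def qtri_add power_int_add power_mult_distrib power_divide power_minus')
  qed
  ultimately show "(?h has_sum qtheta q xi * phi10 q (- d / xi)) (UNIV \<times> UNIV)"
    by (subst has_sum_reindex_bij_witness[where i = "\<lambda>(N, k). (N - int k, k)"
          and j = "\<lambda>(n, k). (n + int k, k)" and T = "UNIV \<times> UNIV"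
          and h = "\<lambda>(N, k). ?f N * ?g k" and s' = "qtheta q xi * phi10 q (- d / xi)"]) auto
  fix n :: int
  have "((\<lambda>k. euler_coeff k * (- (d * q powi n)) ^ k) has_sum qpoch_inf (d * q powi n) q) UNIV"
    by (rule norm_summable_imp_has_sum[OF summable_norm_euler qpoch_inf_sums])
  thus "((\<lambda>k. ?h (n, k)) has_sum ?f n * qpoch_inf (d * q powi n) q) UNIV"
    by (simp add: has_sum_cmult_right)
qed

section \<open>Jacobi's triple product and the zeros of theta\<close>

text \<open>For \<open>d = q\<close> the terms with \<open>n < 0\<close> vanish. For
  \<open>n \<ge> 0\<close> the factor \<open>(q q^n; q)_inf\<close> is
  \<open>(q; q)_inf / (q; q)_n\<close>, which leaves Euler's series for \<open>(-z; q)_inf\<close>.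
  The \<open>phi10\<close> factor is \<open>1 / (-q/z; q)_inf\<close>.\<close>

lemma jacobi_triple_aux:
  assumes "norm q < norm z"
  shows "qtheta q z = qpoch_inf q q * qpoch_inf (- z) q * qpoch_inf (- q / z) q"
proof -
  have z: "z \<noteq> 0"
    using assms by auto
  let ?f = "\<lambda>n. qtri q n * z powi n * qpoch_inf (q * q powi n) q"
  have less: "norm (- q / z) < 1"
    using assms z by (simp add: norm_divide)
  have "(?f has_sum qtheta q z * phi10 q (- q / z)) UNIV"
    by (rule theta_qpoch_inf_has_sum) (use assms z in auto)
  moreover have "?f n = 0" if "n \<notin> range int" for n
  proof -
    have "n < 0"
      using that by (metis nonneg_int_cases not_le rangeI)
    \<comment> \<open>The factor of index \<open>- n - 1\<close> is \<open>1 - q powi 0\<close>, so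
      the product is zero.\<close>
    have "q * q powi n * q ^ nat (- n - 1) = q powi (1 + n + int (nat (- n - 1)))"
      by (simp add: power_int_add flip: power_int_of_nat)
    also have "1 + n + int (nat (- n - 1)) = 0"
      using \<open>n < 0\<close> by simp
    finally show ?thesis
      using qpoch_inf_eq_0_iff by auto
  qed
  ultimately have "(?f has_sum qtheta q z * phi10 q (- q / z)) (range int)"
    by (subst has_sum_cong_neutral[where T = UNIV and g = ?f]) auto
  hence "(\<lambda>n. ?f (int n)) sums (qtheta q z * phi10 q (- q / z))"
    by (subst (asm) has_sum_reindex) (auto simp: o_def intro: has_sum_imp_sums)
  also have "(\<lambda>n. ?f (int n)) = (\<lambda>n. qpoch_inf q q * (euler_coeff n * (- (- z)) ^ n))"
    using qpoch_inf_powi[of q] by (simp add: fun_eq_iff euler_coeff_def del: power_int_of_nat)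
      (simp add: power_int_of_nat)
  finally have "qtheta q z * phi10 q (- q / z) = qpoch_inf q q * qpoch_inf (- z) q"
    using sums_mult[OF qpoch_inf_sums[of "- z"], of "qpoch_inf q q"] sums_unique2 by blast
  thus ?thesis
    using phi10_eq[OF less] qpoch_inf_nz_if_norm_less_1[OF less] by (simp add: field_simps)
qed

text \<open>Passing from \<open>w\<close> to \<open>q * w\<close> divides both sides by
  \<open>w\<close>, so the identity spreads inwards from \<open>norm q < norm z\<close> to the whole
  punctured plane.\<close>

theorem jacobi_triple:
  assumes "z \<noteq> 0"
  shows "qtheta q z = qpoch_inf q q * qpoch_inf (- z) q * qpoch_inf (- q / z) q"
proof -
  obtain n where "norm q ^ n < norm z"
    using real_arch_pow_inv[of "norm z" "norm q"] q_less_1 assms by auto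
  hence "norm q ^ Suc n < norm z"
    using q_less_1 by (smt (verit) mult_left_le_one_le norm_ge_zero power_Suc zero_le_power)
  thus ?thesis
  proof (induction n arbitrary: z)
    case 0
    thus ?case
      by (intro jacobi_triple_aux) simp
  next
    case (Suc n)
    define w where "w = z / q"
    have z: "z = w * q"
      by (simp add: w_def)
    have "norm q ^ Suc n < norm w"
      using Suc.prems q_pos by (simp add: w_def norm_divide field_simps)
    hence IH: "qtheta q w = qpoch_inf q q * qpoch_inf (- w) q * qpoch_inf (- q / w) q"
      by (rule Suc.IH)
    have w: "w \<noteq> 0"
      using \<open>norm q ^ Suc n < norm w\<close> q_pos by (smt (verit) norm_zero zero_less_power)
    have theta: "qtheta q z = qtheta q w / w"
      using theta_shift[OF w, of 1] by (simp add: z)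
    \<comment> \<open>Both shifts are written as multiplications, so \<open>w = -1\<close> needs no
      separate treatment.\<close>
    have 1: "qpoch_inf (- w) q = (1 + w) * qpoch_inf (- z) q"
      using qpoch_inf_shift[of "- w"] by (simp add: z)
    have 2: "qpoch_inf (- q / z) q = (1 + 1 / w) * qpoch_inf (- q / w) q"
      using qpoch_inf_shift[of "- 1 / w"] by (simp add: z)
    show ?case
      using w unfolding theta IH 1 2 by (simp add: field_simps)
  qed
qed

text \<open>By the triple product, \<open>(-z; q)_inf\<close> accounts for the exponents
  \<open>k \<le> 0\<close> and \<open>(-q/z; q)_inf\<close> for \<open>k > 0\<close>.\<close>

lemma theta_eq_0D:
  assumes "z \<noteq> 0" "qtheta q z = 0"
  shows "\<exists>k. z = - (q powi k)"
proof -
  consider "qpoch_inf (- z) q = 0" | "qpoch_inf (- q / z) q = 0"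
    using assms jacobi_triple[of z] by auto
  thus ?thesis
  proof cases
    case 1
    then obtain n where "- z * q ^ n = 1"
      unfolding qpoch_inf_eq_0_iff by blast
    hence "z = - (q powi (- int n))"
      by (simp add: power_int_minus field_simps) (metis add.inverse_inverse)
    thus ?thesis ..
  next
    case 2
    then obtain n where "- q / z * q ^ n = 1"
      unfolding qpoch_inf_eq_0_iff by blast
    hence "z = - (q powi int (Suc n))"
      unfolding power_int_of_nat using assms(1) by (simp add: field_simps)
    thus ?thesis ..
  qed
qed

text \<open>The substitution swaps the two \<open>z\<close>-dependent factors of the triple
  product.\<close>

lemma theta_inversion:
  assumes "z \<noteq> 0"
  shows "qtheta q (q / z) = qtheta q z"
  using assms jacobi_triple[of z] jacobi_triple[of "q / z"] by simp

text \<open>The product formula reduces this to the entire function \<open>euler_exp\<close>,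
  without uniform convergence of the bilateral series.\<close>

lemma theta_holomorphic: "qtheta q holomorphic_on - {0}"
proof -
  have "(\<lambda>z. qpoch_inf q q * euler_exp z * euler_exp (q / z)) holomorphic_on - {0}"
    by (intro holomorphic_intros holomorphic_on_compose_gen[OF _ euler_exp_holomorphic, unfolded o_def])
       auto
  thus ?thesis
    by (rule holomorphic_transform) (simp add: jacobi_triple qpoch_inf_euler)
qed

lemma theta_analytic: "f analytic_on {x} \<Longrightarrow> f x \<noteq> 0 \<Longrightarrow> (\<lambda>x. qtheta q (f x)) analytic_on {x}"
  using theta_holomorphic
  by (intro analytic_on_compose_gen[of f _ "qtheta q" "- {0}", unfolded o_def])
     (auto simp: analytic_on_open open_Compl)

lemma qpoch_inf_analytic: "f analytic_on A \<Longrightarrow> (\<lambda>x. qpoch_inf (f x) q) analytic_on A"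
  using qpoch_inf_holomorphic[of UNIV]
  by (intro analytic_on_compose_gen[of f _ "\<lambda>x. qpoch_inf x q" UNIV, unfolded o_def])
     (auto simp: analytic_on_open)

subsection \<open>Borel and Laplace transforms\<close>

text \<open>For \<open>b \<noteq> 0\<close> the triple product at \<open>q * xi / b\<close> converts
  this into the quotient with \<open>qtheta q (q * xi / b)\<close>. In the present form the possible
  poles come from a single factor.\<close>

lemma q_borel_eq:
  assumes b: "\<And>n. b * q ^ n \<noteq> 1" and xi: "norm b < norm xi"
  shows "q_borel q (psi11_coeff b q) xi = qtheta q xi / (qpoch_inf b q * qpoch_inf (- b / xi) q)"
proof -
  have nz: "xi \<noteq> 0" "qpoch_inf b q \<noteq> 0"
    using xi b by (auto simp: qpoch_inf_eq_0_iff)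
  have less: "norm (- b / xi) < 1"
    using xi nz by (simp add: norm_divide)
  have "((\<lambda>n. qtri q n * xi powi n * qpoch_inf (b * q powi n) q) has_sum
           qtheta q xi * phi10 q (- b / xi)) UNIV"
    by (rule theta_qpoch_inf_has_sum[OF nz(1) xi])
  hence "((\<lambda>n. (1 / qpoch_inf b q) * (qtri q n * xi powi n * qpoch_inf (b * q powi n) q)) has_sum
           (1 / qpoch_inf b q) * (qtheta q xi * phi10 q (- b / xi))) UNIV"
    by (rule has_sum_cmult_right)
  also have "(\<lambda>n. (1 / qpoch_inf b q) * (qtri q n * xi powi n * qpoch_inf (b * q powi n) q)) =
             (\<lambda>n. psi11_coeff b q n * q powi (n * (n - 1) div 2) * xi powi n)"
    using nz by (simp add: fun_eq_iff qpoch_inf_powi[OF b] psi11_coeff_def qtri_def)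
  finally show ?thesis
    unfolding q_borel_def phi10_eq[OF less] by (simp add: infsumI)
qed

text \<open>Points of the spiral have moduli \<open>norm a * norm q powi k\<close>, and no integer
  lies strictly between \<open>n\<close> and \<open>Suc n\<close>.\<close>

lemma annulus_disjoint_qspiral:
  assumes "a \<noteq> 0" "norm a * norm q ^ Suc n < norm x" "norm x < norm a * norm q ^ n"
  shows "x \<notin> qspiral a q"
proof
  assume "x \<in> qspiral a q"
  then obtain k where "x = a * q powi k"
    by (auto simp: qspiral_def)
  hence k: "norm x = norm a * norm q powi k"
    by (simp add: norm_mult norm_power_int)
  have "norm q powi int (Suc n) < norm q powi k" "norm q powi k < norm q powi int n"
    using assms unfolding k power_int_of_nat by auto
  moreover have "norm q powi k \<le> norm q powi i" if "i \<le> k" for i k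
    using that q_pos q_less_1 by (intro power_int_decreasing) auto
  ultimately have "k < int (Suc n)" "int n < k"
    by (meson not_le)+
  thus False
    by simp
qed

text \<open>The closed form is meromorphic on the punctured plane and analytic for
  \<open>norm b < norm xi\<close>, so it is the continuation; where the denominator is nonzero,
  \<open>remove_sings\<close> changes nothing.\<close>

lemma psiA_eq:
  assumes b: "b \<noteq> 0" "\<And>n. b * q ^ n \<noteq> 1" and xi: "xi \<noteq> 0" "qpoch_inf (- b / xi) q \<noteq> 0"
  shows "psiA q b xi = qtheta q xi / (qpoch_inf b q * qpoch_inf (- b / xi) q)"
proof -
  let ?F = "\<lambda>xi. qtheta q xi / (qpoch_inf b q * qpoch_inf (- b / xi) q)"
  have nz: "qpoch_inf b q \<noteq> 0"
    using b by (simp add: qpoch_inf_eq_0_iff)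
  have ana: "?F analytic_on {z}" if "z \<noteq> 0" "qpoch_inf (- b / z) q \<noteq> 0" for z
    using that nz by (intro analytic_intros theta_analytic qpoch_inf_analytic) auto
  have nz': "qpoch_inf (- b / z) q \<noteq> 0" if "norm b < norm z" for z
    using that by (intro qpoch_inf_nz_if_norm_less_1) (simp add: norm_divide divide_simps)
  have "psiA q b xi = remove_sings ?F xi"
    unfolding psiA_def
  proof (rule mero_cont_eq_remove_sings)
    show "open {z :: complex. norm b < norm z \<and> norm z < norm b + 1}"
      by (rule open_norm_annulus)
    show "{z :: complex. norm b < norm z \<and> norm z < norm b + 1} \<noteq> {}"
      by (rule norm_annulus_nonempty) auto
    have "?F meromorphic_on {z}" if "z \<in> - {0}" for z
      using that nz
      by (intro meromorphic_on_divide meromorphic_on_mult analytic_on_imp_meromorphic_on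
            analytic_intros theta_analytic qpoch_inf_analytic) auto
    thus "?F meromorphic_on - {0}"
      by (subst meromorphic_on_meromorphic_at) blast
  next
    fix z :: complex assume z: "z \<in> {z. norm b < norm z}"
    show "?F analytic_on {z}"
      by (rule ana) (use z nz' in auto)
    show "q_borel q (psi11_coeff b q) z = ?F z"
      by (rule q_borel_eq) (use z b in auto)
  qed (use xi open_connected_punctured in auto)
  also have "\<dots> = ?F xi"
    by (rule remove_sings_at_analytic, rule ana) fact+
  finally show ?thesis .
qed

lemma theta_nz_if_not_qspiral:
  assumes "a \<noteq> 0" "c \<noteq> 0" "a \<notin> qspiral (- c) q"
  shows "qtheta q (a / c) \<noteq> 0" "qtheta q (c / a) \<noteq> 0"
proof -
  have *: "a / c \<noteq> - (q powi k)" for k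
    using assms by (auto simp: qspiral_def divide_simps)
  show "qtheta q (a / c) \<noteq> 0"
    using * theta_eq_0D[of "a / c"] assms by auto
  show "qtheta q (c / a) \<noteq> 0"
  proof
    assume "qtheta q (c / a) = 0"
    then obtain k where k: "c / a = - (q powi k)"
      using theta_eq_0D[of "c / a"] assms by auto
    have "a / c = inverse (c / a)"
      by simp
    also have "\<dots> = - (q powi (- k))"
      unfolding k power_int_minus by simp
    finally show False
      using * by blast
  qed
qed

text \<open>Each of the three theta values at shifted arguments contributes a Gaussian factor
  \<open>qtri q n\<close>; one of them survives, so the summand again has the shape of
  \<open>theta_qpoch_inf_has_sum\<close>.\<close>

lemma laplace_has_sum:
  assumes b: "b \<noteq> 0" "\<And>n. b * q ^ n \<noteq> 1"
    and l: "l \<noteq> 0" "l \<notin> qspiral (- b) q"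
    and x: "x \<noteq> 0" "x \<notin> qspiral (- l) q" "norm x < 1"
  shows "((\<lambda>n::int. psiA q b (l * q powi n) / qtheta q (l * q powi n / x)) has_sum
           (qpoch_inf q q / qpoch_inf b q *
            (qtheta q l * qtheta q (l * q / (b * x)) / (qtheta q (q * l / b) * qtheta q (l / x))) *
            phi10 q x)) UNIV"
proof -
  define u where "u = q * l / b"
  define C where "C = qpoch_inf q q / qpoch_inf b q * (qtheta q l / (qtheta q u * qtheta q (l / x)))"
  have u: "u \<noteq> 0"
    using b l by (simp add: u_def)
  have theta_lx: "qtheta q (l / x) \<noteq> 0"
    using theta_nz_if_not_qspiral[of x l] x l by auto
  \<comment> \<open>Inversion moves \<open>u\<close> to \<open>b / l\<close>, where the hypothesis
    that \<open>l\<close> avoids the spiral of \<open>- b\<close> applies.\<close>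
  have "qtheta q u = qtheta q (b / l)"
    using theta_inversion[of "b / l"] b l by (simp add: u_def)
  hence theta_u: "qtheta q u \<noteq> 0"
    using theta_nz_if_not_qspiral[of l b] b l by auto
  have summand: "psiA q b (l * q powi n) / qtheta q (l * q powi n / x) =
                C * (qtri q n * (u / x) powi n * qpoch_inf (- u * q powi n) q)" for n
  proof -
    define z where "z = u * q powi n"
    have z: "z \<noteq> 0"
      using u by (simp add: z_def)
    have qz: "q / z = b / (l * q powi n)"
      using b l by (simp add: z_def u_def field_simps)
    have theta_z: "qtheta q z = qtheta q u / (qtri q n * u powi n)"
      unfolding z_def by (rule theta_shift[OF u])
    have jacobi: "qtheta q z = qpoch_inf q q * qpoch_inf (- z) q * qpoch_inf (- b / (l * q powi n)) q"
      using jacobi_triple[OF z] qz by (simp add: minus_divide_left [symmetric])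
    have "qtheta q z \<noteq> 0"
      using theta_z theta_u u by simp
    \<comment> \<open>A nonzero product has nonzero factors: no point \<open>l * q powi n\<close>
      hits a pole of \<open>psiA\<close>.\<close>
    hence nz: "qpoch_inf (- b / (l * q powi n)) q \<noteq> 0" "qpoch_inf (- z) q \<noteq> 0"
      using jacobi by auto
    have "psiA q b (l * q powi n) =
            qtheta q (l * q powi n) / (qpoch_inf b q * qpoch_inf (- b / (l * q powi n)) q)"
      by (rule psiA_eq) (use b l nz in auto)
    also have "qtheta q (l * q powi n) = qtheta q l / (qtri q n * l powi n)"
      by (rule theta_shift[OF l(1)])
    also have "qpoch_inf (- b / (l * q powi n)) q =
                 qtheta q u / (qtri q n * u powi n) / (qpoch_inf q q * qpoch_inf (- z) q)"
      using jacobi nz unfolding theta_z by (simp add: field_simps)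
    finally have psi: "psiA q b (l * q powi n) = qtheta q l / (qtri q n * l powi n) / (qpoch_inf b q *
        (qtheta q u / (qtri q n * u powi n) / (qpoch_inf q q * qpoch_inf (- z) q)))" .
    have theta: "qtheta q (l * q powi n / x) = qtheta q (l / x) / (qtri q n * (l / x) powi n)"
      using theta_shift[of "l / x" n] l x by (simp add: field_simps)
    show ?thesis
      unfolding psi theta C_def using l x u b theta_lx theta_u nz
      by (simp add: z_def power_int_divide_distrib field_simps)
  qed
  \<comment> \<open>This is where \<open>norm x < 1\<close> enters, as the convergence condition
    with \<open>d = - u\<close> and \<open>xi = u / x\<close>.\<close>
  have "norm (- u) < norm (u / x)"
    using x u by (simp add: norm_divide divide_simps)
  hence "((\<lambda>n. C * (qtri q n * (u / x) powi n * qpoch_inf (- u * q powi n) q)) has_sum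
           C * (qtheta q (u / x) * phi10 q (- (- u) / (u / x)))) UNIV"
    using u x by (intro has_sum_cmult_right theta_qpoch_inf_has_sum) auto
  also have "C * (qtheta q (u / x) * phi10 q (- (- u) / (u / x))) =
     qpoch_inf q q / qpoch_inf b q *
            (qtheta q l * qtheta q (l * q / (b * x)) / (qtheta q (q * l / b) * qtheta q (l / x))) *
            phi10 q x"
    using u x by (simp add: C_def u_def mult_ac)
  finally show ?thesis
    unfolding summand .
qed

section \<open>Continuation in \<open>x\<close> and behaviour at the poles\<close>

lemma phi10_cont_eq: "phi10_cont q x = remove_sings (\<lambda>x. 1 / qpoch_inf x q) x"
  unfolding phi10_cont_def
proof (rule mero_cont_eq_remove_sings[where T = "ball 0 1"])
  show "(\<lambda>x. 1 / qpoch_inf x q) meromorphic_on UNIV"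
    by (intro meromorphic_on_divide analytic_on_imp_meromorphic_on qpoch_inf_analytic analytic_intros)
qed (auto intro!: analytic_intros qpoch_inf_analytic simp: qpoch_inf_nz_if_norm_less_1 phi10_eq)

text \<open>The entire function \<open>qpoch_inf\<close> is nonzero at 0, so its zeros are isolated
  and its reciprocal tends to infinity there.\<close>

lemma is_pole_inverse_qpoch_inf:
  assumes "qpoch_inf x q = 0"
  shows "is_pole (\<lambda>x. 1 / qpoch_inf x q) x"
proof (rule is_pole_divide)
  have ana: "(\<lambda>x. qpoch_inf x q) analytic_on {x}"
    by (intro qpoch_inf_analytic analytic_intros)
  have "eventually (\<lambda>w. qpoch_inf w q \<noteq> 0 \<and> w \<in> UNIV) (at x)"
    by (rule non_zero_neighbour_alt[where \<beta> = 0 and S = UNIV])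
       (auto intro!: qpoch_inf_holomorphic qpoch_inf_nz_if_norm_less_1)
  moreover have "(\<lambda>x. qpoch_inf x q) \<midarrow>x\<rightarrow> 0"
    using analytic_at_imp_isCont[OF ana] assms by (simp add: isCont_def)
  ultimately show "filterlim (\<lambda>x. qpoch_inf x q) (at 0) (at x)"
    by (simp add: filterlim_at)
qed auto

end

theorem theorem1:
  fixes q b l x :: complex
  assumes q: "0 < norm q" "norm q < 1"
    and b: "b \<noteq> 0" "\<And>n::nat. b * q ^ n \<noteq> 1"
    and l: "l \<noteq> 0" "l \<notin> qspiral 1 q" "l \<notin> qspiral (- b) q"
    and x: "x \<noteq> 0" "x \<notin> qspiral (- l) q"
  shows "psiA_tilde q b l x =
           qpoch_inf q q / qpoch_inf b q *
           (qtheta q l * qtheta q (l * q / (b * x)) / (qtheta q (q * l / b) * qtheta q (l / x))) *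
           phi10_cont q x
       \<and> (norm x < 1 \<longrightarrow>
           ((\<lambda>n::int. psiA q b (l * q powi n) / qtheta q (l * q powi n / x)) has_sum
             (qpoch_inf q q / qpoch_inf b q *
              (qtheta q l * qtheta q (l * q / (b * x)) / (qtheta q (q * l / b) * qtheta q (l / x))) *
              phi10 q x)) UNIV)"
proof (intro conjI impI)
  interpret q_base q
    by unfold_locales fact+
  let ?S = "{x. 0 < norm x \<and> norm x < 1} - qspiral (- l) q"
  \<comment> \<open>The candidate for the continuation is \<open>H * p\<close>: a theta quotient
    times the product form of \<open>phi10\<close>.\<close>
  define H where "H = (\<lambda>x. qpoch_inf q q / qpoch_inf b q *
    (qtheta q l * qtheta q (l * q / (b * x)) / (qtheta q (q * l / b) * qtheta q (l / x))))"
  define p where "p = (\<lambda>x. 1 / qpoch_inf x q)"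
  have theta_u: "qtheta q (q * l / b) \<noteq> 0"
    using theta_nz_if_not_qspiral[of l b] theta_inversion[of "b / l"] b l by simp
  have nz: "qpoch_inf b q \<noteq> 0"
    using b by (simp add: qpoch_inf_eq_0_iff)
  have H_mero: "H meromorphic_on {z}" if "z \<noteq> 0" for z
    unfolding H_def using that b l nz theta_u
    by (intro meromorphic_on_divide meromorphic_on_mult analytic_on_imp_meromorphic_on
          theta_analytic analytic_intros) auto
  have H_ana: "H analytic_on {z}" if "z \<noteq> 0" "z \<notin> qspiral (- l) q" for z
    unfolding H_def using that b l nz theta_u theta_nz_if_not_qspiral[of z l]
    by (intro theta_analytic analytic_intros) auto
  have p_mero: "p meromorphic_on A" for A
    unfolding p_def
    by (intro meromorphic_on_divide analytic_on_imp_meromorphic_on qpoch_inf_analytic analytic_intros)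
  have p_ana: "p analytic_on {z}" if "qpoch_inf z q \<noteq> 0" for z
    unfolding p_def using that by (auto intro!: analytic_intros qpoch_inf_analytic)

  \<comment> \<open>The annulus between two consecutive moduli of the spiral avoids it; this choice
    of \<open>n\<close> also puts it inside the unit disc.\<close>
  obtain n where n: "norm q ^ n < 1 / norm l"
    using real_arch_pow_inv[of "1 / norm l" "norm q"] q l by auto
  let ?T = "{x :: complex. norm l * norm q ^ Suc n < norm x \<and> norm x < norm l * norm q ^ n}"
  have "psiA_tilde q b l x = remove_sings (\<lambda>x. H x * p x) x"
    unfolding psiA_tilde_def
  proof (rule mero_cont_eq_remove_sings)
    show "open ?T"
      by (rule open_norm_annulus)
    show "?T \<noteq> {}"
      using q l by (intro norm_annulus_nonempty) auto
    show "?T \<subseteq> ?S"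
    proof
      fix z assume z: "z \<in> ?T"
      hence "z \<notin> qspiral (- l) q"
        using l by (intro annulus_disjoint_qspiral[of _ n]) auto
      moreover have "norm z < 1"
        using z n l by (simp add: field_simps)
      moreover have "0 < norm z"
      proof -
        have "0 \<le> norm l * norm q ^ Suc n"
          by simp
        also have "\<dots> < norm z"
          using z by (simp only: mem_Collect_eq)
        finally show ?thesis .
      qed
      ultimately show "z \<in> ?S"
        by simp
    qed
    have "(\<lambda>x. H x * p x) meromorphic_on {z}" if "z \<in> - {0}" for z
      using that by (intro meromorphic_on_mult H_mero p_mero) auto
    thus "(\<lambda>x. H x * p x) meromorphic_on - {0}"
      by (subst meromorphic_on_meromorphic_at) blast
  next
    fix z assume z: "z \<in> ?S"
    thus "(\<lambda>x. H x * p x) analytic_on {z}"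
      by (intro analytic_intros H_ana p_ana qpoch_inf_nz_if_norm_less_1) auto
    show "q_laplace q l (psiA q b) z = H z * p z"
      unfolding q_laplace_def H_def p_def
      by (rule infsumI) (use z laplace_has_sum[of b l z] b l phi10_eq[of z] in simp)
  qed (use x open_connected_punctured in auto)
  \<comment> \<open>Pulling \<open>H x\<close> out of \<open>remove_sings\<close> is delicate only
    at a pole of \<open>p\<close>, where the right side is 0; the product must then have a pole too,
    or vanish identically.\<close>
  also have "\<dots> = H x * phi10_cont q x"
  proof (cases "qpoch_inf x q = 0")
    case False
    thus ?thesis
      using x unfolding phi10_cont_eq p_def [symmetric]
      by (subst remove_sings_at_analytic; (intro analytic_intros H_ana p_ana)?) (auto simp: p_ana)
  next
    case True
    have pole: "is_pole p x"
      unfolding p_def using True by (rule is_pole_inverse_qpoch_inf)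
    hence "phi10_cont q x = 0"
      unfolding phi10_cont_eq p_def [symmetric] by (rule remove_sings_at_pole)
    moreover have "remove_sings (\<lambda>x. H x * p x) x = 0"
    proof (cases "qtheta q l = 0")
      case True
      thus ?thesis
        by (simp add: H_def)
    next
      case False
      obtain k where k: "x * q ^ k = 1"
        using True qpoch_inf_eq_0_iff by blast
      \<comment> \<open>Poles of \<open>p\<close> lie at \<open>x = 1 / q ^ k\<close>. A theta zero
        there would place \<open>l\<close> on the excluded spiral of \<open>- b\<close>, so
        \<open>H\<close> cannot cancel the pole.\<close>
      have "qtheta q (l * q / (b * x)) \<noteq> 0"
      proof
        assume "qtheta q (l * q / (b * x)) = 0"
        then obtain j where "l * q / (b * x) = - (q powi j)"
          using theta_eq_0D[of "l * q / (b * x)"] b l x by auto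
        hence "l * q * q ^ k = - b * q powi j * (x * q ^ k)"
          using b x by (simp add: field_simps)
        hence "l = - b * (q powi j / q powi int (Suc k))"
          unfolding k power_int_of_nat by (simp add: field_simps)
        also have "q powi j / q powi int (Suc k) = q powi (j - int (Suc k))"
          by (rule power_int_diff [symmetric]) simp
        finally show False
          using l by (auto simp: qspiral_def)
      qed
      hence "H x \<noteq> 0"
        using False nz theta_u theta_nz_if_not_qspiral[of x l] x l by (simp add: H_def)
      thus ?thesis
        using x by (intro remove_sings_at_pole is_pole_mult_analytic_nonzero1 pole H_ana)
    qed
    ultimately show ?thesis
      by simp
  qed
  finally show "psiA_tilde q b l x =
           qpoch_inf q q / qpoch_inf b q *
           (qtheta q l * qtheta q (l * q / (b * x)) / (qtheta q (q * l / b) * qtheta q (l / x))) *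
           phi10_cont q x"
    by (simp add: H_def)
next
  assume "norm x < 1"
  interpret q_base q
    by unfold_locales fact+
  show "((\<lambda>n::int. psiA q b (l * q powi n) / qtheta q (l * q powi n / x)) has_sum
             (qpoch_inf q q / qpoch_inf b q *
              (qtheta q l * qtheta q (l * q / (b * x)) / (qtheta q (q * l / b) * qtheta q (l / x))) *
              phi10 q x)) UNIV"
    by (rule laplace_has_sum) fact+
qed

end
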